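(* For the Poisson $i\mathcal{S}$-graph $G_L$ with $L$ transmission sectors ($L\ge1$), legitimate-node density $\lambda_\ell$ and eavesdropper density $\lambda_{\mathrm e}$, the average node degrees (of a typical node) are $$\mathbb{E}\{N_{\mathrm{in}}\}=\mathbb{E}\{N_{\mathrm{out}}\}=L\,\frac{\lambda_\ell}{\lambda_{\mathrm e}}.$$
   Context: $\Pi_\ell=\{x_i\}$ (legitimate nodes) and $\Pi_{\mathrm e}=\{e_k\}$ (eavesdroppers) are mutually independent homogeneous Poisson point processes on $\mathbb{R}^2$ with densities $\lambda_\ell$ and $\lambda_{\mathrm e}$, respectively. Sectorized graph $G_L$: with each legitimate node $x_i$ are associated $L$ transmission sectors $$\mathcal{S}_i^{(l)}=\left\{z\in\mathbb{R}^2:\phi_i+(l-1)\tfrac{2\pi}{L}<\angle\overrightarrow{x_iz}<\phi_i+l\tfrac{2\pi}{L}\right\},\quad l=1,\dots,L,$$ where $\{\phi_i\}_{i=1}^{\infty}$ are random offset angles with an arbitrary joint distribution, and $\angle\overrightarrow{x_iz}$ is the polar angle of $z-x_i$ (modulo $2\pi$). $G_L$ is the directed graph with vertex set $\Pi_\ell$ in which the edge $\overrightarrow{x_ix_j}$ is present if and only if $|x_i-x_j|<|x_i-e^*|$, where $e^*$ is the eavesdropper in $\Pi_{\mathrm e}\cap\mathcal{S}^*$ closest to $x_i$, and $\mathcal{S}^*$ is the sector $\mathcal{S}_i^{(l)}$ of $x_i$ that contains $x_j$. Typical node: the node at the origin when the graph is built on the legitimate-node set $\Pi_\ell\cup\{0\}$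 with eavesdroppers $\Pi_{\mathrm e}$. The out-degree $N_{\mathrm{out}}$ (resp. in-degree $N_{\mathrm{in}}$) is the number of edges exiting (resp. entering) this node, i.e. the number of $x\in\Pi_\ell$ with an edge $\overrightarrow{0x}$ (resp. $\overrightarrow{x0}$).
   Formalization: The offset angles, with arbitrary joint distribution among themselves, are assumed independent of the legitimate nodes and eavesdroppers; without this the claim fails, e.g. when L = 2 and the origin's offset is chosen from the eavesdropper positions. *)

theory Defs
  imports "HOL-Probability.Probability"
begin

(* A point process is given as a random sequence X, where X w i is the i-th point;
   the underlying random set is range (X w). *)

definition num_points :: "('w \<Rightarrow> nat \<Rightarrow> real^2) \<Rightarrow> (real^2) set \<Rightarrow> 'w \<Rightarrow> nat" where
  "num_points X A \<omega> = card (range (X \<omega>) \<inter> A)"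

(* The enumeration by all of nat is legitimate because, for positive density, the process has
   infinitely many points almost surely. Local finiteness is needed for num_points to be the
   true count on bounded sets, since card is 0 on infinite sets. *)

definition poisson_process :: "'w measure \<Rightarrow> real \<Rightarrow> ('w \<Rightarrow> nat \<Rightarrow> real^2) \<Rightarrow> bool" where
  "poisson_process M \<mu> X \<longleftrightarrow>
     X \<in> M \<rightarrow>\<^sub>M (\<Pi>\<^sub>M i\<in>UNIV. borel) \<and>
     (AE \<omega> in M. inj (X \<omega>)) \<and>
     (AE \<omega> in M. \<forall>B. bounded B \<longrightarrow> finite (range (X \<omega>) \<inter> B)) \<and>
     (\<forall>A k. A \<in> sets borel \<and> bounded A \<longrightarrow>
        measure M {\<omega> \<in> space M. num_points X A \<omega> = k} =
          (\<mu> * measure lborel A) ^ k / fact k * exp (- (\<mu> * measure lborel A))) \<and>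
     (\<forall>(A :: nat \<Rightarrow> (real^2) set) n.
        (\<forall>i<n. A i \<in> sets borel \<and> bounded (A i)) \<and> disjoint_family_on A {..<n} \<longrightarrow>
        prob_space.indep_vars M (\<lambda>_. count_space UNIV) (\<lambda>i. num_points X (A i)) {..<n})"

(* prob_space.indep_var for random elements whose value types differ. *)

definition indep_elements ::
  "'w measure \<Rightarrow> 'a measure \<Rightarrow> ('w \<Rightarrow> 'a) \<Rightarrow> 'b measure \<Rightarrow> ('w \<Rightarrow> 'b) \<Rightarrow> bool" where
  "indep_elements M S U T V \<longleftrightarrow>
     U \<in> M \<rightarrow>\<^sub>M S \<and> V \<in> M \<rightarrow>\<^sub>M T \<and>
     prob_space.indep_set M {U -` A \<inter> space M | A. A \<in> sets S} {V -` B \<inter> space M | B. B \<in> sets T}"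

(* Polar angles are determined modulo 2 * pi; the zero vector has none. *)

definition is_polar_angle :: "real \<Rightarrow> real^2 \<Rightarrow> bool" where
  "is_polar_angle \<theta> v \<longleftrightarrow> v \<noteq> 0 \<and> v = norm v *\<^sub>R vector [cos \<theta>, sin \<theta>]"

definition sector :: "nat \<Rightarrow> real^2 \<Rightarrow> real \<Rightarrow> nat \<Rightarrow> (real^2) set" where
  "sector L x \<phi> l =
     {z. \<exists>\<theta>. is_polar_angle \<theta> (z - x) \<and>
          \<phi> + (real l - 1) * (2 * pi / real L) < \<theta> \<and> \<theta> < \<phi> + real l * (2 * pi / real L)}"

(* x i is the i-th legitimate node, \<phi> i its offset angle, E the set of eavesdroppers.
   If the sector contains no eavesdropper there is no closest one and the edge is present;
   if x j lies on a sector boundary of x i, no sector contains it and the edge is absent.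
   For the processes considered both situations have probability zero. *)

definition secrecy_edges ::
  "nat \<Rightarrow> (nat \<Rightarrow> real^2) \<Rightarrow> (nat \<Rightarrow> real) \<Rightarrow> (real^2) set \<Rightarrow> ((real^2) \<times> (real^2)) set" where
  "secrecy_edges L x \<phi> E =
     {(x i, x j) | i j. \<exists>l\<in>{1..L}. x j \<in> sector L (x i) (\<phi> i) l \<and>
        (\<forall>e. is_arg_min (dist (x i)) (\<lambda>e. e \<in> E \<inter> sector L (x i) (\<phi> i) l) e
              \<longrightarrow> dist (x i) (x j) < dist (x i) e)}"

(* The graph with the typical node added: node 0 is the origin, node Suc i is the i-th point
   of X, and \<Phi> w 0 is the offset angle of the origin. *)

definition typical_edges ::
  "nat \<Rightarrow> ('w \<Rightarrow> nat \<Rightarrow> real^2) \<Rightarrow> ('w \<Rightarrow> nat \<Rightarrow> real) \<Rightarrow> ('w \<Rightarrow> nat \<Rightarrow> real^2)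
     \<Rightarrow> 'w \<Rightarrow> ((real^2) \<times> (real^2)) set" where
  "typical_edges L X \<Phi> Y \<omega> =
     secrecy_edges L (case_nat 0 (X \<omega>)) (\<Phi> \<omega>) (range (Y \<omega>))"

(* Degrees are extended nonnegative reals, so that an infinite degree would count as infinity. *)

definition out_deg ::
  "nat \<Rightarrow> ('w \<Rightarrow> nat \<Rightarrow> real^2) \<Rightarrow> ('w \<Rightarrow> nat \<Rightarrow> real) \<Rightarrow> ('w \<Rightarrow> nat \<Rightarrow> real^2) \<Rightarrow> 'w \<Rightarrow> ennreal" where
  "out_deg L X \<Phi> Y \<omega> =
     emeasure (count_space UNIV) {v \<in> range (X \<omega>). (0, v) \<in> typical_edges L X \<Phi> Y \<omega>}"

definition in_deg ::
  "nat \<Rightarrow> ('w \<Rightarrow> nat \<Rightarrow> real^2) \<Rightarrow> ('w \<Rightarrow> nat \<Rightarrow> real) \<Rightarrow> ('w \<Rightarrow> nat \<Rightarrow> real^2) \<Rightarrow> 'w \<Rightarrow> ennreal" where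
  "in_deg L X \<Phi> Y \<omega> =
     emeasure (count_space UNIV) {v \<in> range (X \<omega>). (v, 0) \<in> typical_edges L X \<Phi> Y \<omega>}"

end

theory Submission
  imports Defs
begin

text \<open>A link of length \<open>r\<close> is present iff no eavesdropper lies in the part of the sender's sector
  within distance \<open>r\<close>. Almost surely the receiver is not on a sector boundary, and then this region
  has area \<open>\<pi> r\<^sup>2 / L\<close> whatever the offset angle, because the \<open>L\<close> sectors are rotations of each other.
  Hence, conditionally on the nodes and the angles, the link has probability
  \<open>exp (- \<lambda>\<^sub>e \<pi> r\<^sup>2 / L)\<close>. In both directions the link between the origin and a node \<open>x\<close> has
  \<open>r = |x|\<close>, so by Campbell's formula both mean degrees equal
  \<open>\<lambda>\<^sub>l \<integral> exp (- \<lambda>\<^sub>e \<pi> |x|\<^sup>2 / L) dx = L \<lambda>\<^sub>l / \<lambda>\<^sub>e\<close>.\<close>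

subsection \<open>Sectors\<close>

definition dir :: "real \<Rightarrow> real^2" where "dir \<theta> = vector [cos \<theta>, sin \<theta>]"

lemma dir_nth [simp]: "dir \<theta> $ 1 = cos \<theta>" "dir \<theta> $ 2 = sin \<theta>"
  by (simp_all add: dir_def)

lemma norm_dir [simp]: "norm (dir \<theta>) = 1"
  by (simp add: norm_vec_def L2_set_def sum_2)

lemma continuous_on_dir: "continuous_on UNIV dir"
proof -
  have "continuous_on UNIV (\<lambda>\<theta>. (\<chi> i. if i = 1 then cos \<theta> else sin \<theta>) :: real^2)"
  proof (rule continuous_on_vec_lambda)
    show "continuous_on UNIV (\<lambda>x. if i = 1 then cos x else sin x :: real)" for i :: 2
      by (cases "i = 1") (auto intro!: continuous_intros)
  qed
  also have "(\<lambda>\<theta>. (\<chi> i. if i = 1 then cos \<theta> else sin \<theta>) :: real^2) = dir"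
    by (auto simp: fun_eq_iff vec_eq_iff forall_2)
  finally show ?thesis .
qed

lemma is_polar_angle_iff: "is_polar_angle \<theta> v \<longleftrightarrow> v \<noteq> 0 \<and> v = norm v *\<^sub>R dir \<theta>"
  by (simp add: is_polar_angle_def dir_def)

text \<open>Polar coordinates with a free radius: as \<open>dir\<close> has unit length, the only
  possible \<open>r\<close> is \<open>norm (z - x)\<close>. In this form a sector is visibly the
  image of an open parameter set.\<close>

lemma mem_sector_iff:
  "z \<in> sector L x \<phi> l \<longleftrightarrow> (\<exists>r \<theta>. r > 0 \<and> \<phi> + (real l - 1) * (2 * pi / real L) < \<theta> \<and>
     \<theta> < \<phi> + real l * (2 * pi / real L) \<and> z = x + r *\<^sub>R dir \<theta>)"
  (is "_ \<longleftrightarrow> ?R")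
proof
  assume "z \<in> sector L x \<phi> l"
  then obtain \<theta> where \<theta>: "is_polar_angle \<theta> (z - x)"
    "\<phi> + (real l - 1) * (2 * pi / real L) < \<theta>" "\<theta> < \<phi> + real l * (2 * pi / real L)"
    by (auto simp: sector_def)
  then have "norm (z - x) > 0" "z = x + norm (z - x) *\<^sub>R dir \<theta>"
    by (auto simp: is_polar_angle_iff algebra_simps)
  then show ?R using \<theta> by blast
next
  assume ?R
  then obtain r \<theta> where *: "r > 0" "\<phi> + (real l - 1) * (2 * pi / real L) < \<theta>"
     "\<theta> < \<phi> + real l * (2 * pi / real L)" "z = x + r *\<^sub>R dir \<theta>" by blast
  have "dir \<theta> \<noteq> 0" by (metis norm_dir norm_zero zero_neq_one)
  then have "is_polar_angle \<theta> (z - x)" using * by (simp add: is_polar_angle_iff)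
  then show "z \<in> sector L x \<phi> l" using * by (auto simp: sector_def)
qed

section \<open>Borel measurability of sectors\<close>

text \<open>An open set of a Euclidean space is a countable union of compact sets; their images are
  compact, hence closed.\<close>

lemma borel_continuous_image_open:
  fixes f :: "'a::euclidean_space \<Rightarrow> 'b::t2_space"
  assumes "open S" "continuous_on S f"
  shows "f ` S \<in> sets borel"
proof -
  obtain C :: "nat \<Rightarrow> 'a set" where C: "\<And>n. compact (C n)" "\<And>n. C n \<subseteq> S" "\<Union>(range C) = S"
    using open_Union_compact_subsets[OF \<open>open S\<close>] by metis
  have "f ` S = (\<Union>n. f ` C n)" using C(3) by auto
  moreover have "closed (f ` C n)" for n
    using C assms by (meson compact_continuous_image compact_imp_closed continuous_on_subset)
  ultimately show ?thesis by auto
qed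

text \<open>The polar angle is quantified over uncountably many values, so measurability comes from
  a continuous parametrization by an open set. Joint measurability in apex, offset and point serves
  random senders and angles.\<close>

lemma sector_graph_borel:
  "{(x, \<phi>, z). z \<in> sector L x \<phi> l} \<in> sets (borel :: ((real^2) \<times> real \<times> (real^2)) measure)"
proof -
  define S :: "((real^2) \<times> real \<times> real \<times> real) set" where
    "S = {(x, \<phi>, r, \<theta>). r > 0 \<and> \<phi> + (real l - 1) * (2 * pi / real L) < \<theta> \<and>
     \<theta> < \<phi> + real l * (2 * pi / real L)}"
  define f where "f = (\<lambda>(x :: real^2, \<phi> :: real, r, \<theta>). (x, \<phi>, x + r *\<^sub>R dir \<theta>))"
  have "open S" unfolding S_def case_prod_unfold
    by (intro open_Collect_conj open_Collect_less continuous_intros)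
  moreover have "continuous_on S f" unfolding f_def case_prod_unfold
    by (intro continuous_intros continuous_on_compose2[OF continuous_on_dir]) auto
  moreover have "{(x, \<phi>, z). z \<in> sector L x \<phi> l} = f ` S"
    unfolding S_def f_def by (fastforce simp: mem_sector_iff image_iff)
  ultimately show ?thesis using borel_continuous_image_open by metis
qed

lemma measurable_mem_sector [measurable]:
  assumes [measurable]: "f \<in> borel_measurable N" "g \<in> borel_measurable N" "h \<in> borel_measurable N"
  shows "Measurable.pred N (\<lambda>w. h w \<in> sector L (f w) (g w) l)"
proof -
  have "(\<lambda>w. (f w, g w, h w)) \<in> N \<rightarrow>\<^sub>M borel"
    by (simp add: borel_prod[symmetric])
  from measurable_sets[OF this sector_graph_borel[of L l]]
  show ?thesis by (simp add: pred_def vimage_def Int_def conj_commute)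
qed

lemma sector_borel [measurable]: "sector L x \<phi> l \<in> sets borel"
proof -
  have "Measurable.pred borel (\<lambda>z. z \<in> sector L x \<phi> l)" by measurable
  then show ?thesis by (simp add: pred_def)
qed

section \<open>Disjointness and covering for the sectors of one node\<close>

lemma dir_eq_iff: "dir a = dir b \<longleftrightarrow> (\<exists>n::int. a = b + 2 * pi * n)"
  using sin_cos_eq_iff[of a b] by (auto simp: vec_eq_iff forall_2)

lemma scaled_dir_eq_imp:
  assumes "r > 0" "s > 0" "r *\<^sub>R dir a = s *\<^sub>R dir b" shows "dir a = dir b"
proof -
  have "norm (r *\<^sub>R dir a) = norm (s *\<^sub>R dir b)" using assms(3) by simp
  then have "r = s" using assms(1,2) by simp
  then show ?thesis using assms by simp
qed

lemma sector_index_unique: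
  assumes "l \<in> {1..L}" "m \<in> {1..L}" "z \<in> sector L x \<phi> l" "z \<in> sector L x \<phi> m"
  shows "l = m"
proof -
  define w where "w = 2 * pi / real L"
  have L: "real L > 0" "real L * w = 2 * pi" "w > 0" using assms by (auto simp: w_def)
  obtain r a where a: "r > 0" "\<phi> + (real l - 1) * w < a" "a < \<phi> + real l * w" "z = x + r *\<^sub>R dir a"
    using assms(3) unfolding mem_sector_iff w_def by blast
  obtain s b where b: "s > 0" "\<phi> + (real m - 1) * w < b" "b < \<phi> + real m * w" "z = x + s *\<^sub>R dir b"
    using assms(4) unfolding mem_sector_iff w_def by blast
  have "dir a = dir b" using scaled_dir_eq_imp[of r s a b] a b by auto
  then obtain n :: int where n: "a = b + 2 * pi * n" by (auto simp: dir_eq_iff)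
  have bounds: "0 \<le> (real k - 1) * w" "real k * w \<le> 2 * pi" if "k \<in> {1..L}" for k
  proof -
    show "0 \<le> (real k - 1) * w" using that L by simp
    have "real k * w \<le> real L * w" using that L by (intro mult_right_mono) auto
    then show "real k * w \<le> 2 * pi" using L by simp
  qed
  \<comment> \<open>Both angles lie strictly between \<open>\<phi>\<close> and
    \<open>\<phi> + 2 * pi\<close>, which leaves no room for a nonzero number of full turns.\<close>
  have "\<bar>a - b\<bar> < 2 * pi" using a b bounds[OF assms(1)] bounds[OF assms(2)] by linarith
  then have "\<bar>real_of_int n\<bar> < 1" using n by (simp add: abs_mult)
  then have "n = 0" by linarith
  then have ab: "a = b" using n by simp
  \<comment> \<open>The common angle lies in two windows of width \<open>w\<close>, so the indices
    differ by less than one.\<close>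
  have "(real l - 1) * w < real m * w" "(real m - 1) * w < real l * w"
    using a b unfolding ab by linarith+
  then have "real l - 1 < real m" "real m - 1 < real l" using L by simp_all
  then show ?thesis by linarith
qed

lemma polar_form_from:
  fixes v :: "real^2"
  assumes "v \<noteq> 0"
  obtains \<theta> where "\<phi> \<le> \<theta>" "\<theta> < \<phi> + 2 * pi" "v = norm v *\<^sub>R dir \<theta>"
proof -
  have n: "norm v > 0" using assms by simp
  have "(v$1)\<^sup>2 + (v$2)\<^sup>2 = (norm v)\<^sup>2"
    by (simp add: norm_vec_def L2_set_def sum_2)
  then have "(v$1 / norm v)\<^sup>2 + (v$2 / norm v)\<^sup>2 = 1" using n
    by (simp add: power_divide add_divide_distrib[symmetric])
  then obtain t where t: "v$1 / norm v = cos t" "v$2 / norm v = sin t"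
    using sincos_total_2pi by metis
  have "v$1 = norm v * cos t" "v$2 = norm v * sin t"
    using n by (simp_all add: t[symmetric])
  then have v: "v = norm v *\<^sub>R dir t" by (simp add: vec_eq_iff forall_2)
  \<comment> \<open>Removes the full turns that separate \<open>t\<close> from the window starting
    at \<open>\<phi>\<close>.\<close>
  define n where "n = - \<lfloor>(t - \<phi>) / (2 * pi)\<rfloor>"
  have "dir (t + 2 * pi * n) = dir t" by (auto simp: dir_eq_iff)
  then have "v = norm v *\<^sub>R dir (t + 2 * pi * n)" by (metis v)
  moreover have "real_of_int (-n) \<le> (t - \<phi>) / (2 * pi)" "(t - \<phi>) / (2 * pi) < real_of_int (-n) + 1"
    unfolding n_def by linarith+
  then have "\<phi> \<le> t + 2 * pi * n" "t + 2 * pi * n < \<phi> + 2 * pi"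
    by (simp_all add: field_simps)
  ultimately show ?thesis using that by blast
qed

text \<open>The full lines carrying the boundary rays: unlike the rays, they are invariant under
  \<open>v \<mapsto> - v\<close>, which serves both edge directions.\<close>

definition boundary_lines :: "nat \<Rightarrow> real \<Rightarrow> (real^2) set" where
  "boundary_lines L \<phi> = (\<Union>k<L. {v. let \<theta> = \<phi> + real k * (2 * pi / real L) in
     vector [- sin \<theta>, cos \<theta>] \<bullet> v = 0})"

lemma uminus_mem_boundary_lines [simp]: "- v \<in> boundary_lines L \<phi> \<longleftrightarrow> v \<in> boundary_lines L \<phi>"
  by (simp add: boundary_lines_def Let_def)

text \<open>Finitely many hyperplanes, each with a nonzero normal because \<open>sin\<close> and
  \<open>cos\<close> have no common zero.\<close>

lemma negligible_boundary_lines: "negligible (boundary_lines L \<phi>)"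
proof -
  have "vector [- sin \<theta>, cos \<theta>] \<noteq> (0 :: real^2)" for \<theta>
  proof
    assume "vector [- sin \<theta>, cos \<theta>] = (0 :: real^2)"
    then have "sin \<theta> = 0" "cos \<theta> = 0" by (auto simp: vec_eq_iff forall_2)
    then show False using sin_cos_squared_add[of \<theta>] by simp
  qed
  then show ?thesis unfolding boundary_lines_def Let_def
    by (intro negligible_Union finite_imageI finite_lessThan) (auto intro!: negligible_hyperplane)
qed

lemma boundary_lines_borel [measurable]: "boundary_lines L \<phi> \<in> sets borel"
  unfolding boundary_lines_def Let_def by (intro sets.finite_UN) (auto intro!: borel_closed closed_hyperplane)

lemma emeasure_boundary_lines: "emeasure lborel (boundary_lines L \<phi>) = 0"
  using negligible_boundary_lines[of L \<phi>]
  by (simp add: negligible_iff_null_sets null_sets_def)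

text \<open>Dividing the angle past \<open>\<phi>\<close> by the opening \<open>w\<close> yields the
  index; a zero remainder would put \<open>z - x\<close> on a boundary line.\<close>

lemma sectors_cover:
  assumes "L \<ge> 1" "z - x \<notin> boundary_lines L \<phi>"
  shows "\<exists>l\<in>{1..L}. z \<in> sector L x \<phi> l"
proof -
  define w where "w = 2 * pi / real L"
  have L: "real L > 0" "real L * w = 2 * pi" "w > 0" using assms by (auto simp: w_def)
  \<comment> \<open>The lines pass through the origin and L \<ge> 1 provides one, so
    \<open>z - x\<close> is nonzero and has a polar angle.\<close>
  have "0 \<in> boundary_lines L \<phi>" using assms using lessThan_iff[of 0 L] by (force simp: boundary_lines_def Let_def)
  then have "z - x \<noteq> 0" using assms by metis
  then obtain \<theta> where \<theta>: "\<phi> \<le> \<theta>" "\<theta> < \<phi> + 2 * pi" "z - x = norm (z - x) *\<^sub>R dir \<theta>"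
    by (rule polar_form_from)
  \<comment> \<open>\<open>k\<close> counts from 0 and sectors count from 1, so the sector found is
    number \<open>Suc k\<close>.\<close>
  define k where "k = nat \<lfloor>(\<theta> - \<phi>) / w\<rfloor>"
  have "0 \<le> (\<theta> - \<phi>) / w" using \<theta> L by simp
  then have k: "real k \<le> (\<theta> - \<phi>) / w" "(\<theta> - \<phi>) / w < real k + 1"
    unfolding k_def by linarith+
  then have k': "real k * w \<le> \<theta> - \<phi>" "\<theta> - \<phi> < (real k + 1) * w" using L by (simp_all add: field_simps)
  then have "real k * w < real L * w" using \<theta> L by linarith
  then have kL: "k < L" using \<open>w > 0\<close> by (simp only: mult_less_cancel_right_pos of_nat_less_iff)
  have "\<theta> \<noteq> \<phi> + real k * w"
  proof
    assume eq: "\<theta> = \<phi> + real k * w"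
    \<comment> \<open>For this angle the normal of line \<open>k\<close> is orthogonal to
      \<open>dir \<theta>\<close>.\<close>
    have "(vector [- sin \<theta>, cos \<theta>] :: real^2) \<bullet> (z - x) = norm (z - x) * (vector [- sin \<theta>, cos \<theta>] \<bullet> dir \<theta>)"
      using arg_cong[OF \<theta>(3), of "\<lambda>v. vector [- sin \<theta>, cos \<theta>] \<bullet> v"]
      by (simp only: inner_scaleR_right)
    also have "\<dots> = 0" by (simp add: inner_vec_def sum_2)
    finally have "z - x \<in> boundary_lines L \<phi>"
      using kL eq unfolding boundary_lines_def Let_def w_def by blast
    then show False using assms by simp
  qed
  then have "\<phi> + real k * w < \<theta>" using k' by linarith
  moreover have "\<theta> < \<phi> + real (Suc k) * w" using k' by (simp add: algebra_simps)
  moreover have "z = x + norm (z - x) *\<^sub>R dir \<theta>"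
    using \<theta>(3) by (metis add.commute diff_add_cancel)
  ultimately have "z \<in> sector L x \<phi> (Suc k)"
    unfolding mem_sector_iff w_def[symmetric] using \<open>z - x \<noteq> 0\<close>
    by (intro exI[of _ "norm (z - x)"] exI[of _ \<theta>] conjI) simp_all
  then show ?thesis using kL by (intro bexI[of _ "Suc k"]) auto
qed

section \<open>Area of a sector within a disc around its apex\<close>

lemma sector_translate: "sector L x \<phi> l = (+) x ` sector L 0 \<phi> l"
  by (auto simp: mem_sector_iff image_iff) (metis add_0)+

definition rot :: "real \<Rightarrow> real^2 \<Rightarrow> real^2" where
  "rot \<alpha> v = vector [cos \<alpha> * v$1 - sin \<alpha> * v$2, sin \<alpha> * v$1 + cos \<alpha> * v$2]"

lemma rot_nth [simp]:
  "rot \<alpha> v $ 1 = cos \<alpha> * v$1 - sin \<alpha> * v$2" "rot \<alpha> v $ 2 = sin \<alpha> * v$1 + cos \<alpha> * v$2"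
  by (simp_all add: rot_def)

lemma linear_rot: "linear (rot \<alpha>)"
  by (rule linearI) (auto simp: vec_eq_iff forall_2 algebra_simps)

lemma rot_scaled_dir: "rot \<alpha> (r *\<^sub>R dir \<theta>) = r *\<^sub>R dir (\<theta> + \<alpha>)"
  by (auto simp: vec_eq_iff forall_2 cos_add sin_add algebra_simps)

lemma det_rot: "det (matrix (rot \<alpha>)) = 1"
  by (simp add: det_2 matrix_def axis_def power2_eq_square[symmetric])

lemma norm_rot [simp]: "norm (rot \<alpha> v) = norm v"
proof -
  have "(c * a - s * b)\<^sup>2 + (s * a + c * b)\<^sup>2 = (c\<^sup>2 + s\<^sup>2) * (a\<^sup>2 + b\<^sup>2)" for a b c s :: real
    by (simp add: power2_eq_square algebra_simps)
  from this[of "cos \<alpha>" "v$1" "sin \<alpha>" "v$2"] show ?thesis by (simp add: norm_vec_def L2_set_def sum_2)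
qed

text \<open>The angle \<open>\<alpha>\<close> turns the initial ray of the first sector into that of
  the second, all sectors have the same opening, and rotations about the origin keep the
  disc.\<close>

lemma rot_sector_cball:
  assumes "\<alpha> = \<phi>' + (real l' - 1) * (2 * pi / real L) - (\<phi> + (real l - 1) * (2 * pi / real L))"
  shows "rot \<alpha> ` (sector L 0 \<phi> l \<inter> cball 0 r) \<subseteq> sector L 0 \<phi>' l' \<inter> cball 0 r"
proof safe
  define w where "w = 2 * pi / real L"
  fix v assume "v \<in> sector L 0 \<phi> l" "v \<in> cball 0 r"
  then obtain s \<theta> where *: "s > 0" "\<phi> + (real l - 1) * w < \<theta>"
     "\<theta> < \<phi> + real l * w" "v = s *\<^sub>R dir \<theta>"
    by (auto simp: mem_sector_iff w_def)
  then have "rot \<alpha> v = 0 + s *\<^sub>R dir (\<theta> + \<alpha>)" by (simp add: rot_scaled_dir)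
  moreover have "\<phi>' + (real l' - 1) * w < \<theta> + \<alpha>" "\<theta> + \<alpha> < \<phi>' + real l' * w"
    using * assms[folded w_def] by (simp_all add: algebra_simps)
  ultimately show "rot \<alpha> v \<in> sector L 0 \<phi>' l'" using \<open>s > 0\<close>
    unfolding mem_sector_iff w_def by blast
  show "rot \<alpha> v \<in> cball 0 r" using \<open>v \<in> cball 0 r\<close> by (simp add: mem_cball_0)
qed

lemma fmeasurable_sector_cball: "sector L x \<phi> l \<inter> cball y r \<in> fmeasurable lborel"
  by (rule fmeasurableI2[of "cball y r"])
    (auto intro!: fmeasurable_compact simp: sets_lborel)

text \<open>Rotations preserve area. Exchanging the two sectors gives the reverse inequality, hence
  equality.\<close>

lemma measure_sector_mono:
  "measure lborel (sector L 0 \<phi> l \<inter> cball 0 r) \<le> measure lborel (sector L 0 \<phi>' l' \<inter> cball 0 r)"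
    (is "measure _ ?A \<le> measure _ ?B")
proof -
  define \<alpha> where "\<alpha> = \<phi>' + (real l' - 1) * (2 * pi / real L) - (\<phi> + (real l - 1) * (2 * pi / real L))"
  have b: "?A \<in> sets borel" "?B \<in> sets borel" by auto
  have f: "?A \<in> lmeasurable" "?B \<in> lmeasurable"
    by (auto intro!: bounded_set_imp_lmeasurable bounded_Int)
  have "measure lborel ?A = measure lebesgue ?A" using b by simp
  \<comment> \<open>Linear change of variables with factor
    \<open>\<bar>det\<bar> = 1\<close>.\<close>
  also have "\<dots> = measure lebesgue (rot \<alpha> ` ?A)"
    using measure_linear_image[OF linear_rot f(1)] by (simp add: det_rot)
  also have "\<dots> \<le> measure lebesgue ?B"
    using f by (intro measure_mono_fmeasurable rot_sector_cball[OF \<alpha>_def] fmeasurableD measurable_linear_image linear_rot)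
  also have "\<dots> = measure lborel ?B" using b by simp
  finally show ?thesis .
qed

text \<open>The \<open>L\<close> sectors have equal areas and tile the disc up to the null set of
  boundary lines, so each receives the share \<open>1 / L\<close>.\<close>

lemma measure_sector_cball_0:
  assumes "l \<in> {1..L}" "r \<ge> 0"
  shows "measure lborel (sector L 0 \<phi> l \<inter> cball 0 r) = pi * r\<^sup>2 / real L"
proof -
  let ?S = "\<lambda>l. sector L 0 \<phi> l \<inter> cball 0 r"
  have eq: "measure lborel (?S m) = measure lborel (?S l)" for m
    by (intro antisym measure_sector_mono)
  have "measure lborel (cball 0 r :: (real^2) set) = measure lborel (\<Union>m\<in>{1..L}. ?S m)"
  proof (rule measure_eq_AE)
    have "AE v in lborel. v \<notin> boundary_lines L \<phi>"
      using emeasure_boundary_lines by (auto intro!: AE_not_in simp: null_sets_def)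
    then show "AE v in lborel. v \<in> cball 0 r \<longleftrightarrow> v \<in> (\<Union>m\<in>{1..L}. ?S m)"
    proof eventually_elim
      case (elim v)
      then show ?case using sectors_cover[of L v 0 \<phi>] assms by auto
    qed
  qed auto
  also have "\<dots> = (\<Sum>m\<in>{1..L}. measure lborel (?S m))"
  proof (rule measure_finite_Union)
    show "disjoint_family_on ?S {1..L}"
      unfolding disjoint_family_on_def using sector_index_unique[where x = 0 and L = L and \<phi> = \<phi>] by blast
    show "emeasure lborel (?S m) \<noteq> \<infinity>" for m
      using fmeasurableD2[OF fmeasurable_sector_cball] by simp
  qed auto
  also have "\<dots> = (\<Sum>m\<in>{1..L}. measure lborel (?S l))" by (intro sum.cong eq refl)
  finally have "real L * measure lborel (?S l) = measure lborel (cball 0 r :: (real^2) set)"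
    by simp
  also have "\<dots> = pi * r\<^sup>2"
    using content_cball[OF assms(2), of "0 :: real^2"] by (simp add: unit_ball_vol_2)
  finally show ?thesis using assms by (auto simp: field_simps)
qed

lemma measure_sector_cball:
  assumes "l \<in> {1..L}" "r \<ge> 0"
  shows "measure lborel (sector L x \<phi> l \<inter> cball x r) = pi * r\<^sup>2 / real L"
proof -
  have "sector L x \<phi> l \<inter> cball x r = (+) x ` (sector L 0 \<phi> l \<inter> cball 0 r)"
    by (subst sector_translate) (auto simp: image_iff dist_norm)
  then have "measure lebesgue (sector L x \<phi> l \<inter> cball x r) = measure lebesgue (sector L 0 \<phi> l \<inter> cball 0 r)"
    by (simp add: measure_translation)
  then show ?thesis using measure_sector_cball_0[OF assms, of \<phi>] by simp
qed

subsection \<open>Poisson processes\<close>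

lemma poisson_process_component:
  assumes "poisson_process M \<mu> X"
  shows "(\<lambda>\<omega>. X \<omega> i) \<in> borel_measurable M"
proof -
  have "X \<in> M \<rightarrow>\<^sub>M (\<Pi>\<^sub>M i\<in>UNIV. borel)" using assms by (simp add: poisson_process_def)
  from measurable_compose[OF this measurable_component_singleton[OF UNIV_I]] show ?thesis .
qed

lemma poisson_process_AE:
  assumes "poisson_process M \<mu> X"
  shows "AE \<omega> in M. inj (X \<omega>)" "AE \<omega> in M. \<forall>B. bounded B \<longrightarrow> finite (range (X \<omega>) \<inter> B)"
  using assms unfolding poisson_process_def by blast+

lemma poisson_process_measure:
  assumes "poisson_process M \<mu> X" "A \<in> sets borel" "bounded A"
  shows "measure M {\<omega> \<in> space M. num_points X A \<omega> = k} =
    (\<mu> * measure lborel A) ^ k / fact k * exp (- (\<mu> * measure lborel A))"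
  using assms unfolding poisson_process_def by blast

text \<open>The independence clause of \<open>poisson_process\<close>, applied to a one-element
  family, contains the measurability of the count.\<close>

lemma measurable_num_points:
  assumes "prob_space M" "poisson_process M \<mu> X" "A \<in> sets borel" "bounded A"
  shows "num_points X A \<in> M \<rightarrow>\<^sub>M count_space UNIV"
proof -
  interpret prob_space M by fact
  have "\<And>(B :: nat \<Rightarrow> (real^2) set) n. (\<forall>i<n. B i \<in> sets borel \<and> bounded (B i)) \<Longrightarrow>
      disjoint_family_on B {..<n} \<Longrightarrow> indep_vars (\<lambda>_. count_space UNIV) (\<lambda>i. num_points X (B i)) {..<n}"
    using assms(2) unfolding poisson_process_def by blast
  from this[of 1 "\<lambda>_. A"] have "indep_vars (\<lambda>_. count_space UNIV) (\<lambda>i. num_points X A) {..<1::nat}"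
    using assms(3,4) by (simp add: disjoint_family_on_def)
  then show ?thesis unfolding indep_vars_def by simp
qed

lemma poisson_process_void:
  assumes "prob_space M" "poisson_process M \<mu> X" "A \<in> sets borel" "bounded A"
  shows "emeasure M {\<omega> \<in> space M. range (X \<omega>) \<inter> A = {}} = ennreal (exp (- (\<mu> * measure lborel A)))"
proof -
  interpret prob_space M by fact
  note [measurable] = poisson_process_component[OF assms(2)] measurable_num_points[OF assms] assms(3)
  \<comment> \<open>As a condition on countably many points, emptiness is a measurable
    event.\<close>
  have "{\<omega> \<in> space M. range (X \<omega>) \<inter> A = {}} = {\<omega> \<in> space M. \<forall>i. X \<omega> i \<notin> A}" by auto
  then have [measurable]: "{\<omega> \<in> space M. range (X \<omega>) \<inter> A = {}} \<in> sets M" by simp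
  have "measure M {\<omega> \<in> space M. range (X \<omega>) \<inter> A = {}} = measure M {\<omega> \<in> space M. num_points X A \<omega> = 0}"
  proof (rule measure_eq_AE)
    \<comment> \<open>\<open>card\<close> is 0 on infinite sets too, so a zero count means emptiness
      only almost surely, by local finiteness.\<close>
    show "AE \<omega> in M. \<omega> \<in> {\<omega> \<in> space M. range (X \<omega>) \<inter> A = {}} \<longleftrightarrow>
      \<omega> \<in> {\<omega> \<in> space M. num_points X A \<omega> = 0}"
      using poisson_process_AE(2)[OF assms(2)]
      by eventually_elim (use \<open>bounded A\<close> in \<open>auto simp: num_points_def\<close>)
  qed auto
  also have "\<dots> = exp (- (\<mu> * measure lborel A))"
    using poisson_process_measure[OF assms(2-4), of 0] by simp
  finally show ?thesis by (simp add: emeasure_eq_measure)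
qed

section \<open>Mean counts and Campbell's formula\<close>

text \<open>Cancelling \<open>k\<close> against \<open>fact k\<close> leaves
  \<open>m * exp (- m)\<close> times the exponential series; the term at 0 vanishes, which permits
  the index shift.\<close>

lemma sums_poisson_mean: "(\<lambda>k. real k * (m ^ k / fact k * exp (- m))) sums m"
proof -
  have "(\<lambda>k. (m ^ k /\<^sub>R fact k) * (m * exp (- m))) sums (exp m * (m * exp (- m)))"
    by (intro sums_mult2 exp_converges)
  also have "exp m * (m * exp (- m)) = m" by (simp add: exp_minus)
  also have "(\<lambda>k. (m ^ k /\<^sub>R fact k) * (m * exp (- m))) =
      (\<lambda>k. real (Suc k) * (m ^ Suc k / fact (Suc k) * exp (- m)))"
    by (simp add: fun_eq_iff field_simps del: of_nat_Suc)
  finally show ?thesis by (subst (asm) sums_Suc_iff) simp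
qed

lemma nn_integral_num_points:
  assumes "prob_space M" "poisson_process M \<mu> X" "A \<in> sets borel" "bounded A" "\<mu> \<ge> 0"
  shows "(\<integral>\<^sup>+\<omega>. ennreal (real (num_points X A \<omega>)) \<partial>M) = ennreal (\<mu> * measure lborel A)"
proof -
  interpret prob_space M by fact
  note [measurable] = measurable_num_points[OF assms(1-4)]
  define m where "m = \<mu> * measure lborel A"
  have "m \<ge> 0" using assms by (simp add: m_def)
  let ?E = "\<lambda>k. {\<omega> \<in> space M. num_points X A \<omega> = k}"
  have "(\<integral>\<^sup>+\<omega>. ennreal (real (num_points X A \<omega>)) \<partial>M)
      = (\<integral>\<^sup>+\<omega>. (\<Sum>k. ennreal (real k) * indicator (?E k) \<omega>) \<partial>M)"
  proof (rule nn_integral_cong)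
    fix \<omega> assume "\<omega> \<in> space M"
    then have "(\<Sum>k. ennreal (real k) * indicator (?E k) \<omega>)
      = (\<Sum>k\<in>{num_points X A \<omega>}. ennreal (real k) * indicator (?E k) \<omega>)"
      by (intro suminf_finite) auto
    then show "ennreal (real (num_points X A \<omega>)) = (\<Sum>k. ennreal (real k) * indicator (?E k) \<omega>)"
      using \<open>\<omega> \<in> space M\<close> by simp
  qed
  also have "\<dots> = (\<Sum>k. ennreal (real k) * emeasure M (?E k))"
    by (subst nn_integral_suminf) (auto simp: nn_integral_cmult)
  also have "\<dots> = (\<Sum>k. ennreal (real k * (m ^ k / fact k * exp (- m))))"
    unfolding m_def
    by (simp only: emeasure_eq_measure poisson_process_measure[OF assms(2-4)] ennreal_mult' of_nat_0_le_iff)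
  also have "\<dots> = ennreal m"
    using sums_poisson_mean \<open>m \<ge> 0\<close> by (intro suminf_ennreal_eq) auto
  finally show ?thesis by (simp add: m_def)
qed

text \<open>The sum over points integrates \<open>f\<close> against the intensity measure. On boxes
  this measure is \<open>\<mu>\<close> times the volume, so it is \<open>\<mu>\<close> times
  Lebesgue measure.\<close>

lemma campbell:
  fixes f :: "real^2 \<Rightarrow> ennreal"
  assumes "prob_space M" "poisson_process M \<mu> X" "\<mu> > 0" and [measurable]: "f \<in> borel_measurable borel"
  shows "(\<integral>\<^sup>+\<omega>. (\<Sum>i. f (X \<omega> i)) \<partial>M) = ennreal \<mu> * (\<integral>\<^sup>+x. f x \<partial>lborel)"
proof -
  interpret prob_space M by fact
  note [measurable] = poisson_process_component[OF assms(2)]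
  define P where "P = count_space (UNIV :: nat set) \<Otimes>\<^sub>M M"
  \<comment> \<open>Intensity measure: the expected number of indices whose point falls in a given
    set.\<close>
  define \<nu> where "\<nu> = distr P borel (\<lambda>(i, \<omega>). X \<omega> i)"
  interpret C: sigma_finite_measure "count_space (UNIV :: nat set)"
    by (rule sigma_finite_measure_count_space)
  interpret CM: pair_sigma_finite "count_space (UNIV :: nat set)" M ..
  have X: "(\<lambda>(i, \<omega>). X \<omega> i) \<in> borel_measurable P"
    unfolding P_def by (rule measurable_pair_measure_countable1) auto
  have nn: "(\<integral>\<^sup>+x. g x \<partial>\<nu>) = (\<integral>\<^sup>+\<omega>. (\<Sum>i. g (X \<omega> i)) \<partial>M)"
    if [measurable]: "g \<in> borel_measurable borel" for g :: "real^2 \<Rightarrow> ennreal"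
  proof -
    have "(\<integral>\<^sup>+x. g x \<partial>\<nu>) = (\<integral>\<^sup>+p. g (case p of (i, \<omega>) \<Rightarrow> X \<omega> i) \<partial>P)"
      unfolding \<nu>_def by (rule nn_integral_distr[OF X]) simp
    also have "\<dots> = (\<integral>\<^sup>+\<omega>. (\<integral>\<^sup>+i. g (X \<omega> i) \<partial>count_space UNIV) \<partial>M)"
      unfolding P_def using measurable_compose[OF X that, unfolded P_def]
      by (subst CM.nn_integral_snd[symmetric]) auto
    finally show ?thesis by (simp add: nn_integral_count_space_nat)
  qed
  \<comment> \<open>Lebesgue measure is characterized by its values on boxes; dividing by
    \<open>\<mu> > 0\<close> brings the intensity measure to that form.\<close>
  have "lborel = scale_measure (ennreal (1 / \<mu>)) \<nu>"
  proof (rule lborel_eqI)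
    fix l u :: "real^2" assume le: "\<And>b. b \<in> Basis \<Longrightarrow> l \<bullet> b \<le> u \<bullet> b"
    have "emeasure \<nu> (box l u) = (\<integral>\<^sup>+x. indicator (box l u) x \<partial>\<nu>)"
      by (simp add: \<nu>_def)
    also have "\<dots> = (\<integral>\<^sup>+\<omega>. (\<Sum>i. indicator (box l u) (X \<omega> i)) \<partial>M)" by (rule nn) simp
    also have "\<dots> = (\<integral>\<^sup>+\<omega>. ennreal (real (num_points X (box l u) \<omega>)) \<partial>M)"
    proof (rule nn_integral_cong_AE)
      show "AE \<omega> in M. (\<Sum>i. indicator (box l u) (X \<omega> i)) = ennreal (real (num_points X (box l u) \<omega>))"
        using poisson_process_AE[OF assms(2)]
      proof eventually_elim
        case (elim \<omega>)
        define I where "I = {i. X \<omega> i \<in> box l u}"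
        have im: "X \<omega> ` I = range (X \<omega>) \<inter> box l u" by (auto simp: I_def)
        \<comment> \<open>The sum counts indices while \<open>num_points\<close> counts points;
          injectivity equates the two, and local finiteness keeps \<open>card\<close>
          meaningful.\<close>
        have inj: "inj_on (X \<omega>) I" using elim by (meson inj_on_subset subset_UNIV)
        have fin: "finite I" using elim im bounded_box inj by (metis finite_imageD)
        have "(\<Sum>i. indicator (box l u) (X \<omega> i)) = (\<Sum>i\<in>I. indicator (box l u) (X \<omega> i) :: ennreal)"
          using fin by (intro suminf_finite) (auto simp: I_def)
        also have "\<dots> = (\<Sum>i\<in>I. 1)" by (intro sum.cong) (auto simp: I_def)
        also have "\<dots> = ennreal (real (card I))" by (simp add: ennreal_of_nat_eq_real_of_nat)
        also have "card I = num_points X (box l u) \<omega>"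
          unfolding num_points_def im[symmetric] using inj by (simp add: card_image)
        finally show ?case .
      qed
    qed
    also have "\<dots> = ennreal (\<mu> * measure lborel (box l u))"
      using assms by (intro nn_integral_num_points) auto
    finally have "emeasure \<nu> (box l u) = ennreal (\<mu> * (\<Prod>b\<in>Basis. (u - l) \<bullet> b))"
      using le by (simp add: measure_lborel_box)
    then show "emeasure (scale_measure (ennreal (1 / \<mu>)) \<nu>) (box l u) = (\<Prod>b\<in>Basis. (u - l) \<bullet> b)"
      using assms(3) by (simp add: ennreal_mult'[symmetric])
  qed (simp add: \<nu>_def)
  moreover have "f \<in> borel_measurable \<nu>" by (simp add: \<nu>_def)
  ultimately have "(\<integral>\<^sup>+x. f x \<partial>lborel) = ennreal (1 / \<mu>) * (\<integral>\<^sup>+x. f x \<partial>\<nu>)"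
    by (metis nn_integral_scale_measure)
  then have "ennreal \<mu> * (\<integral>\<^sup>+x. f x \<partial>lborel) = ennreal (\<mu> * (1 / \<mu>)) * (\<integral>\<^sup>+x. f x \<partial>\<nu>)"
    using assms(3) by (simp only: ennreal_mult' less_imp_le mult.assoc)
  then show ?thesis using assms(3) nn[OF assms(4)] by simp
qed

text \<open>The expected number of points in \<open>N\<close> is \<open>\<mu>\<close> times its
  area, hence 0, and a nonnegative variable of mean 0 vanishes almost surely.\<close>

lemma poisson_process_avoids_null_set:
  assumes "prob_space M" "poisson_process M \<mu> X" "\<mu> > 0" "N \<in> null_sets lborel"
  shows "AE \<omega> in M. X \<omega> i \<notin> N"
proof -
  note [measurable] = poisson_process_component[OF assms(2)]
  have [measurable]: "N \<in> sets borel" using assms(4) by auto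
  have "(\<integral>\<^sup>+\<omega>. (\<Sum>i. indicator N (X \<omega> i)) \<partial>M) = 0"
    using assms by (subst campbell[OF assms(1-3)]) auto
  then have "AE \<omega> in M. (\<Sum>i. indicator N (X \<omega> i) :: ennreal) = 0"
    by (subst (asm) nn_integral_0_iff_AE) auto
  then show ?thesis
  proof eventually_elim
    case (elim \<omega>)
    then have "indicator N (X \<omega> i) = (0 :: ennreal)" by (simp add: suminf_eq_zero_iff)
    then show ?case by (simp add: indicator_eq_0_iff)
  qed
qed

section \<open>The Gaussian integral over the plane\<close>

lemma nn_integral_gaussian_plane:
  assumes "a > 0"
  shows "(\<integral>\<^sup>+x. ennreal (exp (- (a * (norm (x :: real^2))\<^sup>2))) \<partial>lborel) = ennreal (pi / a)"
proof -
  \<comment> \<open>Layer cake: \<open>exp (- a |x|\<^sup>2)\<close> is the integral of \<open>exp (- t)\<close> over \<open>t \<ge> a |x|\<^sup>2\<close>; then swap the integrals.\<close>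
  let ?f = "\<lambda>(x :: real^2) t. ennreal (exp (- t)) * indicator {a * (norm x)\<^sup>2 ..} t"
  have [measurable]: "case_prod ?f \<in> borel_measurable (lborel \<Otimes>\<^sub>M lborel)"
    unfolding indicator_def atLeast_iff by measurable
  have tail: "(\<integral>\<^sup>+t. ?f x t \<partial>lborel) = ennreal (exp (- (a * (norm x)\<^sup>2)))" for x
  proof -
    have "((\<lambda>t :: real. - exp (- t)) \<longlongrightarrow> - 0) at_top"
      by (intro tendsto_minus filterlim_compose[OF exp_at_bot] filterlim_uminus_at_bot_at_top)
    moreover have "((\<lambda>t. - exp (- t)) has_real_derivative exp (- t)) (at t)" for t :: real
      by (auto intro!: derivative_eq_intros)
    ultimately show ?thesis
      using nn_integral_FTC_atLeast[of "\<lambda>t. exp (- t)" "a * (norm x)\<^sup>2" "\<lambda>t. - exp (- t)" "- 0"]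
      by simp
  qed
  \<comment> \<open>For t \<ge> 0 the region is a disc of area \<open>pi * t / a\<close>; for
    negative \<open>t\<close> both sides are 0. The power \<open>t ^ 1\<close> prepares the Gamma
    integral, whose value is \<open>fact 1\<close>.\<close>
  have ball: "(\<integral>\<^sup>+x. ?f x t \<partial>lborel) = ennreal (pi / a) * (ennreal (t ^ 1 * exp (- t)) * indicator {0..} t)" for t
  proof (cases "t \<ge> 0")
    case True
    have iff: "a * (norm x)\<^sup>2 \<le> t \<longleftrightarrow> norm x \<le> sqrt (t / a)" for x :: "real^2"
    proof -
      have "a * (norm x)\<^sup>2 \<le> t \<longleftrightarrow> (norm x)\<^sup>2 \<le> t / a" using assms by (simp add: field_simps)
      also have "\<dots> \<longleftrightarrow> norm x \<le> sqrt (t / a)" by (metis real_sqrt_le_iff real_sqrt_abs abs_norm_cancel)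
      finally show ?thesis .
    qed
    have "(\<integral>\<^sup>+x. ?f x t \<partial>lborel) = (\<integral>\<^sup>+x. ennreal (exp (- t)) * indicator (cball 0 (sqrt (t / a))) (x :: real^2) \<partial>lborel)"
      by (intro nn_integral_cong) (auto simp: indicator_def iff)
    also have "\<dots> = ennreal (exp (- t)) * ennreal (pi * (t / a))"
      using True assms by (subst nn_integral_cmult_indicator) (auto simp: emeasure_cball unit_ball_vol_2)
    also have "\<dots> = ennreal (pi / a) * (ennreal (t ^ 1 * exp (- t)) * indicator {0..} t)"
      using True assms by (simp add: ennreal_mult[symmetric] field_simps)
    finally show ?thesis .
  next
    case False
    then have "?f x t = 0" for x
    proof -
      have "0 \<le> a * (norm x)\<^sup>2" using assms by simp
      then show ?thesis using False by (auto simp: indicator_def)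
    qed
    then show ?thesis using False by simp
  qed
  have "(\<integral>\<^sup>+x. ennreal (exp (- (a * (norm (x :: real^2))\<^sup>2))) \<partial>lborel) = (\<integral>\<^sup>+x. (\<integral>\<^sup>+t. ?f x t \<partial>lborel) \<partial>lborel)"
    by (simp only: tail)
  also have "\<dots> = (\<integral>\<^sup>+t. (\<integral>\<^sup>+x. ?f x t \<partial>lborel) \<partial>lborel)"
    by (rule lborel_pair.Fubini'[symmetric]) measurable
  also have "\<dots> = ennreal (pi / a) * (\<integral>\<^sup>+t. ennreal (t ^ 1 * exp (- t)) * indicator {0..} t \<partial>lborel)"
    unfolding ball by (rule nn_integral_cmult) measurable
  also have "\<dots> = ennreal (pi / a)" unfolding nn_intergal_power_times_exp_Ici by simp
  finally show ?thesis .
qed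

subsection \<open>Expected number of secure links\<close>

text \<open>The edge condition without reference to a closest eavesdropper; for locally finite \<open>E\<close> it is
  equivalent to the one used in \<open>secrecy_edges\<close>.\<close>

definition secure_link :: "nat \<Rightarrow> real^2 \<Rightarrow> real \<Rightarrow> (real^2) set \<Rightarrow> real^2 \<Rightarrow> bool" where
  "secure_link L s \<psi> E t \<longleftrightarrow>
     (\<exists>l\<in>{1..L}. t \<in> sector L s \<psi> l \<and> E \<inter> (sector L s \<psi> l \<inter> cball s (dist s t)) = {})"

text \<open>Emptiness becomes a quantifier over the indices \<open>k\<close>, so only countably many
  measurable conditions occur.\<close>

lemma pred_secure_link:
  fixes y :: "'w \<Rightarrow> nat \<Rightarrow> real^2"
  assumes [measurable]: "f \<in> borel_measurable N" "g \<in> borel_measurable N" "h \<in> borel_measurable N"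
    "\<And>k. (\<lambda>w. y w k) \<in> borel_measurable N"
  shows "Measurable.pred N (\<lambda>w. secure_link L (f w) (g w) (range (y w)) (h w))"
proof -
  have "secure_link L (f w) (g w) (range (y w)) (h w) \<longleftrightarrow>
    (\<exists>l\<in>{1..L}. h w \<in> sector L (f w) (g w) l \<and>
      (\<forall>k. \<not> (y w k \<in> sector L (f w) (g w) l \<and> dist (f w) (y w k) \<le> dist (f w) (h w))))" for w
    unfolding secure_link_def by (auto simp: disjoint_iff)
  then show ?thesis by (simp only:) measurable
qed

text \<open>The receiver singles out one sector, so security is the void event of a region of area
  \<open>pi * (dist s t)\<^sup>2 / L\<close>.\<close>

lemma emeasure_secure_link:
  assumes "prob_space M" "poisson_process M \<mu> Y" "\<exists>l\<in>{1..L}. t \<in> sector L s \<psi> l"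
  shows "emeasure M {\<omega> \<in> space M. secure_link L s \<psi> (range (Y \<omega>)) t}
    = ennreal (exp (- (\<mu> * pi / real L * (dist s t)\<^sup>2)))"
proof -
  from assms(3) obtain l where l: "l \<in> {1..L}" "t \<in> sector L s \<psi> l" by blast
  let ?A = "sector L s \<psi> l \<inter> cball s (dist s t)"
  have "secure_link L s \<psi> E t \<longleftrightarrow> E \<inter> ?A = {}" for E
    unfolding secure_link_def using l sector_index_unique[OF _ l(1) _ l(2)] by blast
  then have "emeasure M {\<omega> \<in> space M. secure_link L s \<psi> (range (Y \<omega>)) t}
      = ennreal (exp (- (\<mu> * measure lborel ?A)))"
    using poisson_process_void[OF assms(1,2), of ?A] by (simp add: bounded_Int)
  also have "measure lborel ?A = pi * (dist s t)\<^sup>2 / real L"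
    using l by (intro measure_sector_cball) auto
  finally show ?thesis by simp
qed

text \<open>By independence the two measures agree on measurable rectangles, which determine a
  product of sigma-finite measures.\<close>

lemma (in prob_space) indep_elements_distr:
  assumes "indep_elements M S U T V"
  shows "distr M S U \<Otimes>\<^sub>M distr M T V = distr M (S \<Otimes>\<^sub>M T) (\<lambda>\<omega>. (U \<omega>, V \<omega>))"
proof -
  have [measurable]: "U \<in> M \<rightarrow>\<^sub>M S" "V \<in> M \<rightarrow>\<^sub>M T"
    and ind: "indep_set {U -` A \<inter> space M | A. A \<in> sets S} {V -` B \<inter> space M | B. B \<in> sets T}"
    using assms by (auto simp: indep_elements_def)
  interpret U: prob_space "distr M S U" by (rule prob_space_distr) measurable
  interpret V: prob_space "distr M T V" by (rule prob_space_distr) measurable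
  show ?thesis
  proof (rule pair_measure_eqI)
    show "sigma_finite_measure (distr M S U)" "sigma_finite_measure (distr M T V)" by unfold_locales
    fix A B assume "A \<in> sets (distr M S U)" "B \<in> sets (distr M T V)"
    then have [measurable]: "A \<in> sets S" "B \<in> sets T" by auto
    have "prob ((U -` A \<inter> space M) \<inter> (V -` B \<inter> space M)) = prob (U -` A \<inter> space M) * prob (V -` B \<inter> space M)"
      by (rule indep_setD[OF ind]) auto
    moreover have "(U -` A \<inter> space M) \<inter> (V -` B \<inter> space M) = (\<lambda>\<omega>. (U \<omega>, V \<omega>)) -` (A \<times> B) \<inter> space M"
      by auto
    ultimately show "emeasure (distr M S U) A * emeasure (distr M T V) B
      = emeasure (distr M (S \<Otimes>\<^sub>M T) (\<lambda>\<omega>. (U \<omega>, V \<omega>))) (A \<times> B)"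
      by (simp add: emeasure_distr emeasure_eq_measure ennreal_mult'[symmetric])
  qed simp
qed

abbreviation seqs :: "(nat \<Rightarrow> 'a::topological_space) measure" where
  "seqs \<equiv> \<Pi>\<^sub>M i\<in>UNIV. borel"

text \<open>The link runs from \<open>s x\<close> to \<open>t x\<close> and uses the offset angle with index \<open>k i\<close>; the two
  degrees are the instances \<open>(s x, t x, k i) = (0, x, 0)\<close> and \<open>(x, 0, Suc i)\<close>. Given \<open>X\<close> and \<open>\<Phi>\<close>, the
  conditional probability of the link does not depend on \<open>\<Phi>\<close>.\<close>

lemma expected_secure_links:
  fixes s t :: "real^2 \<Rightarrow> real^2" and k :: "nat \<Rightarrow> nat"
  assumes "prob_space M" "L \<ge> 1" "\<alpha> > 0" "\<beta> > 0"
    and X: "poisson_process M \<alpha> X" and Y: "poisson_process M \<beta> Y"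
    and XY: "prob_space.indep_var M seqs X seqs Y"
    and \<Phi>: "indep_elements M (seqs \<Otimes>\<^sub>M seqs) (\<lambda>\<omega>. (X \<omega>, Y \<omega>)) seqs \<Phi>"
    and [measurable]: "s \<in> borel_measurable borel" "t \<in> borel_measurable borel"
    and st: "\<And>x. t x - s x = x \<or> t x - s x = - x"
  shows "(\<integral>\<^sup>+\<omega>. (\<Sum>i. indicator {\<omega>. secure_link L (s (X \<omega> i)) (\<Phi> \<omega> (k i)) (range (Y \<omega>)) (t (X \<omega> i))} \<omega>) \<partial>M)
    = ennreal (real L * (\<alpha> / \<beta>))"
proof -
  interpret prob_space M by fact
  have [measurable]: "X \<in> M \<rightarrow>\<^sub>M seqs" using X[unfolded poisson_process_def, THEN conjunct1] .
  have [measurable]: "Y \<in> M \<rightarrow>\<^sub>M seqs" using Y[unfolded poisson_process_def, THEN conjunct1] .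
  have [measurable]: "\<Phi> \<in> M \<rightarrow>\<^sub>M seqs"
    using \<Phi>[unfolded indep_elements_def, THEN conjunct2, THEN conjunct1] .
  define DX DY D\<Phi> where "DX = distr M seqs X" and "DY = distr M seqs Y" and "D\<Phi> = distr M seqs \<Phi>"
  interpret DX: prob_space DX unfolding DX_def by (rule prob_space_distr) measurable
  interpret DY: prob_space DY unfolding DY_def by (rule prob_space_distr) measurable
  interpret D\<Phi>: prob_space D\<Phi> unfolding D\<Phi>_def by (rule prob_space_distr) measurable
  interpret XY: pair_prob_space DX DY ..
  interpret XY\<Phi>: pair_prob_space "DX \<Otimes>\<^sub>M DY" D\<Phi> ..
  have sets_D [measurable_cong]: "sets DX = sets seqs" "sets DY = sets seqs" "sets D\<Phi> = sets seqs"
    by (simp_all add: DX_def DY_def D\<Phi>_def)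
  \<comment> \<open>\<open>c * r\<^sup>2\<close> is the mean number of eavesdroppers within distance
    \<open>r\<close> in one sector, so \<open>g x\<close> is the conditional probability of a link
    of length \<open>norm x\<close>.\<close>
  define c where "c = \<beta> * pi / real L"
  have "c > 0" using assms by (simp add: c_def)
  define g where "g = (\<lambda>x :: real^2. ennreal (exp (- (c * (norm x)\<^sup>2))))"
  have [measurable]: "g \<in> borel_measurable borel" by (simp add: g_def)
  define l where "l = (\<lambda>x (y :: nat \<Rightarrow> real^2) \<phi> i. secure_link L (s (x i)) (\<phi> (k i)) (range y) (t (x i)))"
  define A where "A = (\<lambda>i. {((x, y), \<phi>). l x y \<phi> i})"
  define F where "F = (\<lambda>z. \<Sum>i. indicator (A i) z :: ennreal)"
  have dist_st: "dist (s x) (t x) = norm x" for x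
    unfolding dist_norm norm_minus_commute[of "s x"] using st[of x] norm_minus_cancel[of x] by metis
  have pred_l: "Measurable.pred N (\<lambda>w. l (x w) (y w) (\<phi> w) i)"
    if [measurable]: "x \<in> N \<rightarrow>\<^sub>M seqs" "y \<in> N \<rightarrow>\<^sub>M seqs" "\<phi> \<in> N \<rightarrow>\<^sub>M seqs" for N :: "'n measure" and x y \<phi> i
    unfolding l_def by (rule pred_secure_link) measurable
  have UNIV_seqs [simp]: "space (seqs :: (nat \<Rightarrow> 'z::topological_space) measure) = UNIV"
    by (simp add: space_PiM)
  have A [measurable]: "A i \<in> sets ((seqs \<Otimes>\<^sub>M seqs) \<Otimes>\<^sub>M seqs)" for i
  proof -
    have "Measurable.pred ((seqs \<Otimes>\<^sub>M seqs) \<Otimes>\<^sub>M seqs) (\<lambda>z. l (fst (fst z)) (snd (fst z)) (snd z) i)"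
      by (rule pred_l) measurable
    then show ?thesis
      by (simp add: pred_def space_pair_measure A_def case_prod_beta')
  qed
  have F [measurable]: "F \<in> borel_measurable ((seqs \<Otimes>\<^sub>M seqs) \<Otimes>\<^sub>M seqs)"
    unfolding F_def by measurable
  \<comment> \<open>With nodes and angles frozen, only the eavesdroppers are averaged.\<close>
  have inner: "(\<integral>\<^sup>+y. indicator (A i) ((x, y), \<phi>) \<partial>DY) = g (x i)"
    if "x i \<notin> boundary_lines L (\<phi> (k i))" for x \<phi> i
  proof -
    \<comment> \<open>The lines are symmetric about the origin, which covers the displacement
      \<open>- x i\<close>.\<close>
    have "t (x i) - s (x i) \<notin> boundary_lines L (\<phi> (k i))"
      using st[of "x i"] that by auto
    then have "\<exists>m\<in>{1..L}. t (x i) \<in> sector L (s (x i)) (\<phi> (k i)) m"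
      by (rule sectors_cover[OF assms(2)])
    from emeasure_secure_link[OF assms(1) Y this]
    have em: "emeasure M {\<omega> \<in> space M. l x (Y \<omega>) \<phi> i} = g (x i)"
      unfolding g_def c_def dist_st l_def .
    have "Measurable.pred seqs (\<lambda>y. l x y \<phi> i)"
      by (rule pred_l) (auto intro!: measurable_const)
    then have meas: "{y. l x y \<phi> i} \<in> sets seqs"
      unfolding pred_def UNIV_seqs by simp
    have "(\<integral>\<^sup>+y. indicator (A i) ((x, y), \<phi>) \<partial>DY) = (\<integral>\<^sup>+y. indicator {y. l x y \<phi> i} y \<partial>DY)"
      by (simp add: A_def indicator_def)
    also have "\<dots> = emeasure DY {y. l x y \<phi> i}"
      using meas by (intro nn_integral_indicator) (simp add: sets_D)
    also have "\<dots> = emeasure M (Y -` {y. l x y \<phi> i} \<inter> space M)"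
      unfolding DY_def by (rule emeasure_distr) (use meas in \<open>simp_all\<close>)
    also have "Y -` {y. l x y \<phi> i} \<inter> space M = {\<omega> \<in> space M. l x (Y \<omega>) \<phi> i}" by auto
    finally show ?thesis using em by simp
  qed
  have "(\<integral>\<^sup>+\<omega>. (\<Sum>i. indicator {\<omega>. l (X \<omega>) (Y \<omega>) (\<Phi> \<omega>) i} \<omega>) \<partial>M) = (\<integral>\<^sup>+\<omega>. F ((X \<omega>, Y \<omega>), \<Phi> \<omega>) \<partial>M)"
    by (simp add: F_def A_def indicator_def)
  \<comment> \<open>The two independence hypotheses make the joint law a product: first for
    \<open>X\<close> and \<open>Y\<close>, then for this pair and \<open>\<Phi>\<close>. The
    components of \<open>\<Phi>\<close> may depend on each other.\<close>
  also have "\<dots> = (\<integral>\<^sup>+z. F z \<partial>((DX \<Otimes>\<^sub>M DY) \<Otimes>\<^sub>M D\<Phi>))"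
  proof -
    have "DX \<Otimes>\<^sub>M DY = distr M (seqs \<Otimes>\<^sub>M seqs) (\<lambda>\<omega>. (X \<omega>, Y \<omega>))"
      using XY unfolding indep_var_distribution_eq DX_def DY_def by simp
    then have "(DX \<Otimes>\<^sub>M DY) \<Otimes>\<^sub>M D\<Phi> = distr M ((seqs \<Otimes>\<^sub>M seqs) \<Otimes>\<^sub>M seqs) (\<lambda>\<omega>. ((X \<omega>, Y \<omega>), \<Phi> \<omega>))"
      using indep_elements_distr[OF \<Phi>] by (simp add: D\<Phi>_def)
    then show ?thesis by (simp add: nn_integral_distr)
  qed
  \<comment> \<open>Angles outermost and eavesdroppers innermost, so that each stage works with
    fixed values of the outer variables.\<close>
  also have "\<dots> = (\<integral>\<^sup>+\<phi>. (\<integral>\<^sup>+z. F (z, \<phi>) \<partial>(DX \<Otimes>\<^sub>M DY)) \<partial>D\<Phi>)"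
    by (rule XY\<Phi>.nn_integral_snd[symmetric]) measurable
  also have "\<dots> = (\<integral>\<^sup>+\<phi>. (\<integral>\<^sup>+x. (\<integral>\<^sup>+y. F ((x, y), \<phi>) \<partial>DY) \<partial>DX) \<partial>D\<Phi>)"
    by (intro nn_integral_cong DY.nn_integral_fst[symmetric]) measurable
  also have "\<dots> = (\<integral>\<^sup>+\<phi>. ennreal (real L * (\<alpha> / \<beta>)) \<partial>D\<Phi>)"
  proof (rule nn_integral_cong)
    fix \<phi> :: "nat \<Rightarrow> real"
    \<comment> \<open>For a fixed sequence \<open>\<phi>\<close>, countably many null sets are
      avoided simultaneously.\<close>
    have "AE \<omega> in M. \<forall>i. X \<omega> i \<notin> boundary_lines L (\<phi> (k i))"
      using poisson_process_avoids_null_set[OF assms(1) X assms(3)] emeasure_boundary_lines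
      by (auto simp: AE_all_countable null_sets_def)
    then have "AE x in DX. \<forall>i. x i \<notin> boundary_lines L (\<phi> (k i))"
      unfolding DX_def by (subst AE_distr_iff) measurable
    then have "AE x in DX. (\<integral>\<^sup>+y. F ((x, y), \<phi>) \<partial>DY) = (\<Sum>i. g (x i))"
    proof eventually_elim
      case (elim x)
      have "(\<integral>\<^sup>+y. F ((x, y), \<phi>) \<partial>DY) = (\<Sum>i. \<integral>\<^sup>+y. indicator (A i) ((x, y), \<phi>) \<partial>DY)"
        unfolding F_def by (rule nn_integral_suminf) measurable
      then show ?case using inner elim by simp
    qed
    then have "(\<integral>\<^sup>+x. (\<integral>\<^sup>+y. F ((x, y), \<phi>) \<partial>DY) \<partial>DX) = (\<integral>\<^sup>+x. (\<Sum>i. g (x i)) \<partial>DX)"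
      by (rule nn_integral_cong_AE)
    also have "\<dots> = (\<integral>\<^sup>+\<omega>. (\<Sum>i. g (X \<omega> i)) \<partial>M)"
      unfolding DX_def by (rule nn_integral_distr) measurable
    \<comment> \<open>Campbell's formula, then the Gaussian integral with coefficient
      \<open>c\<close>, where \<open>pi / c = L / \<beta>\<close>.\<close>
    also have "\<dots> = ennreal \<alpha> * ennreal (pi / c)"
      unfolding campbell[OF assms(1) X assms(3) \<open>g \<in> borel_measurable borel\<close>]
      using nn_integral_gaussian_plane[OF \<open>c > 0\<close>] by (simp add: g_def)
    also have "\<dots> = ennreal (real L * (\<alpha> / \<beta>))"
      using assms by (simp add: c_def ennreal_mult'[symmetric] field_simps)
    finally show "(\<integral>\<^sup>+x. (\<integral>\<^sup>+y. F ((x, y), \<phi>) \<partial>DY) \<partial>DX) = ennreal (real L * (\<alpha> / \<beta>))" .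
  qed
  also have "\<dots> = ennreal (real L * (\<alpha> / \<beta>))" by (simp add: D\<Phi>.emeasure_space_1)
  finally show ?thesis by (simp add: l_def)
qed

subsection \<open>Degrees\<close>

text \<open>Counting first occurrences avoids assuming \<open>x\<close> injective: as \<open>M\<close> need not be complete,
  measurability of the degrees cannot be derived from almost sure properties of the processes.\<close>

lemma emeasure_count_space_range:
  fixes x :: "nat \<Rightarrow> 'a"
  shows "emeasure (count_space UNIV) {v \<in> range x. P v}
    = (\<Sum>i. of_bool (P (x i) \<and> (\<forall>j<i. x j \<noteq> x i)))"
proof -
  let ?I = "{i. P (x i) \<and> (\<forall>j<i. x j \<noteq> x i)}"
  have bij: "bij_betw x ?I {v \<in> range x. P v}"
    unfolding bij_betw_def
  proof
    show "inj_on x ?I" by (rule inj_onI) (metis (mono_tags, lifting) mem_Collect_eq nat_neq_iff)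
    show "x ` ?I = {v \<in> range x. P v}"
    proof safe
      fix i assume "P (x i)"
      define n where "n = (LEAST j. x j = x i)"
      have "x n = x i" unfolding n_def by (rule LeastI) (rule refl)
      moreover have "\<forall>j<n. x j \<noteq> x n" using \<open>x n = x i\<close> not_less_Least unfolding n_def by metis
      ultimately show "x i \<in> x ` ?I" using \<open>P (x i)\<close> by (intro image_eqI[of _ _ n]) auto
    qed auto
  qed
  have "emeasure (count_space UNIV) {v \<in> range x. P v} = emeasure (count_space UNIV) ?I"
    using bij_betw_finite[OF bij] bij_betw_same_card[OF bij] by (simp add: emeasure_count_space)
  also have "\<dots> = (\<integral>\<^sup>+i. indicator ?I i \<partial>count_space UNIV)" by simp
  also have "\<dots> = (\<Sum>i. indicator ?I i)" by (rule nn_integral_count_space_nat)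
  finally show ?thesis by (simp add: indicator_def)
qed

section \<open>The edge relation: measurability and almost sure form\<close>

text \<open>For measurability: minimality and comparison are tested on indices, so every quantifier
  is countable. The equivalence holds for every sequence, hence at every sample point.\<close>

lemma closer_than_nearest_range_iff:
  "(\<forall>e. is_arg_min (dist x) (\<lambda>e. e \<in> range y \<inter> S) e \<longrightarrow> d < dist x e) \<longleftrightarrow>
    (\<forall>k. y k \<in> S \<and> (\<forall>m. y m \<in> S \<longrightarrow> \<not> dist x (y m) < dist x (y k)) \<longrightarrow> d < dist x (y k))"
proof -
  have "(\<forall>e. e \<in> range y \<inter> S \<and> P e \<longrightarrow> Q e) \<longleftrightarrow> (\<forall>k. y k \<in> S \<and> P (y k) \<longrightarrow> Q (y k))" for P Q
    by auto
  moreover have "(\<nexists>e. e \<in> range y \<inter> S \<and> dist x e < c) \<longleftrightarrow> (\<forall>m. y m \<in> S \<longrightarrow> \<not> dist x (y m) < c)" for c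
    by auto
  ultimately show ?thesis unfolding is_arg_min_def by simp
qed

lemma pred_mem_secrecy_edges:
  fixes x y :: "'w \<Rightarrow> nat \<Rightarrow> real^2" and \<phi> :: "'w \<Rightarrow> nat \<Rightarrow> real"
  assumes [measurable]: "a \<in> borel_measurable N" "b \<in> borel_measurable N"
    "\<And>i. (\<lambda>w. x w i) \<in> borel_measurable N" "\<And>i. (\<lambda>w. \<phi> w i) \<in> borel_measurable N"
    "\<And>i. (\<lambda>w. y w i) \<in> borel_measurable N"
  shows "Measurable.pred N (\<lambda>w. (a w, b w) \<in> secrecy_edges L (x w) (\<phi> w) (range (y w)))"
  unfolding secrecy_edges_def closer_than_nearest_range_iff mem_Collect_eq prod.inject by measurable

text \<open>By local finiteness, eavesdroppers of the sector in the closed disc include a nearest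
  one, which violates the strict inequality. With none in the sector, both sides hold.\<close>

lemma closer_than_nearest_iff:
  assumes "\<forall>B. bounded B \<longrightarrow> finite (E \<inter> B)"
  shows "(\<forall>e. is_arg_min (dist x) (\<lambda>e. e \<in> E \<inter> S) e \<longrightarrow> dist x y < dist x e) \<longleftrightarrow>
    E \<inter> (S \<inter> cball x (dist x y)) = {}" (is "?L \<longleftrightarrow> ?F = {}")
proof
  assume ?L
  show "?F = {}"
  proof (rule ccontr)
    assume "?F \<noteq> {}"
    moreover have "finite ?F" using assms by (simp add: bounded_Int)
    ultimately obtain e where e: "is_arg_min (dist x) (\<lambda>e. e \<in> ?F) e"
      using ex_is_arg_min_if_finite by metis
    \<comment> \<open>Points of the sector outside the disc are farther away, so the nearest one in
      the disc is nearest in the whole sector.\<close>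
    have "dist x e \<le> dist x e'" if "e' \<in> E \<inter> S" for e'
    proof (cases "dist x e' \<le> dist x y")
      case True
      then show ?thesis using e that by (simp add: is_arg_min_linorder)
    next
      case False
      then show ?thesis using e by (simp add: is_arg_min_linorder)
    qed
    with e have "is_arg_min (dist x) (\<lambda>e. e \<in> E \<inter> S) e"
      unfolding is_arg_min_linorder by simp
    with \<open>?L\<close> e show False by (auto simp: is_arg_min_def)
  qed
next
  assume "?F = {}"
  then show ?L by (auto simp: is_arg_min_def disjoint_iff not_le)
qed

text \<open>Edges are pairs of points while angles belong to indices; injectivity recovers the
  indices from the points.\<close>

lemma mem_secrecy_edges_iff_secure_link:
  assumes "inj x" "\<forall>B. bounded B \<longrightarrow> finite (E \<inter> B)"
  shows "(x i, x j) \<in> secrecy_edges L x \<phi> E \<longleftrightarrow> secure_link L (x i) (\<phi> i) E (x j)"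
proof -
  have "(x i, x j) \<in> {(x i, x j) |i j. Q i j} \<longleftrightarrow> Q i j" for Q
    using assms(1) by (auto simp: inj_eq)
  then show ?thesis
    unfolding secrecy_edges_def secure_link_def closer_than_nearest_iff[OF assms(2)] by (rule trans) simp
qed

lemma inj_case_nat:
  assumes "inj x" "\<And>i. x i \<noteq> a"
  shows "inj (case_nat a x)"
proof (rule injI)
  fix i j assume "case_nat a x i = case_nat a x j"
  then show "i = j"
    using assms injD[OF assms(1)] assms(2)[symmetric] by (cases i; cases j) auto
qed

theorem corollary4p1:
  fixes M :: "'w measure" and L :: nat and lam_l lam_e :: real
    and X Y :: "'w \<Rightarrow> nat \<Rightarrow> real^2" and \<Phi> :: "'w \<Rightarrow> nat \<Rightarrow> real"
  assumes "prob_space M" and "L \<ge> 1" and "lam_l > 0" and "lam_e > 0"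
    and "poisson_process M lam_l X"
    and "poisson_process M lam_e Y"
    and "prob_space.indep_var M
           (\<Pi>\<^sub>M i\<in>UNIV. borel) X
           (\<Pi>\<^sub>M i\<in>UNIV. borel) Y"
    and "indep_elements M
           ((\<Pi>\<^sub>M i\<in>UNIV. borel) \<Otimes>\<^sub>M (\<Pi>\<^sub>M i\<in>UNIV. borel)) (\<lambda>\<omega>. (X \<omega>, Y \<omega>))
           (\<Pi>\<^sub>M i\<in>UNIV. borel) \<Phi>"
  shows "in_deg L X \<Phi> Y \<in> borel_measurable M \<and>
         out_deg L X \<Phi> Y \<in> borel_measurable M \<and>
         (\<integral>\<^sup>+\<omega>. in_deg L X \<Phi> Y \<omega> \<partial>M) = (\<integral>\<^sup>+\<omega>. out_deg L X \<Phi> Y \<omega> \<partial>M) \<and>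
         (\<integral>\<^sup>+\<omega>. out_deg L X \<Phi> Y \<omega> \<partial>M) = ennreal (real L * (lam_l / lam_e))"
proof -
  interpret prob_space M by fact
  let ?Z = "\<lambda>\<omega>. case_nat 0 (X \<omega>) :: nat \<Rightarrow> real^2"
  have X [measurable]: "(\<lambda>\<omega>. X \<omega> i) \<in> borel_measurable M" for i
    by (rule poisson_process_component[OF assms(5)])
  have Y [measurable]: "(\<lambda>\<omega>. Y \<omega> i) \<in> borel_measurable M" for i
    by (rule poisson_process_component[OF assms(6)])
  have "\<Phi> \<in> M \<rightarrow>\<^sub>M seqs" using assms(8) by (simp add: indep_elements_def)
  from measurable_compose[OF this measurable_component_singleton[OF UNIV_I]]
  have \<Phi>: "(\<lambda>\<omega>. \<Phi> \<omega> i) \<in> borel_measurable M" for i .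
  have Z: "(\<lambda>\<omega>. ?Z \<omega> i) \<in> borel_measurable M" for i
    by (cases i) simp_all
  have [measurable]:
    "Measurable.pred M (\<lambda>\<omega>. (0, X \<omega> i) \<in> typical_edges L X \<Phi> Y \<omega>)"
    "Measurable.pred M (\<lambda>\<omega>. (X \<omega> i, 0) \<in> typical_edges L X \<Phi> Y \<omega>)" for i
    unfolding typical_edges_def
    by (rule pred_mem_secrecy_edges[OF borel_measurable_const X Z \<Phi> Y]
      pred_mem_secrecy_edges[OF X borel_measurable_const Z \<Phi> Y])+
  have out_eq: "out_deg L X \<Phi> Y = (\<lambda>\<omega>. \<Sum>i. indicator
      {\<omega>. (0, X \<omega> i) \<in> typical_edges L X \<Phi> Y \<omega> \<and> (\<forall>j<i. X \<omega> j \<noteq> X \<omega> i)} \<omega>)"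
    unfolding out_deg_def emeasure_count_space_range by (simp only: indicator_def mem_Collect_eq)
  have in_eq: "in_deg L X \<Phi> Y = (\<lambda>\<omega>. \<Sum>i. indicator
      {\<omega>. (X \<omega> i, 0) \<in> typical_edges L X \<Phi> Y \<omega> \<and> (\<forall>j<i. X \<omega> j \<noteq> X \<omega> i)} \<omega>)"
    unfolding in_deg_def emeasure_count_space_range by (simp only: indicator_def mem_Collect_eq)
  \<comment> \<open>The origin alone is a null set, so the added typical node almost surely
    coincides with no other node.\<close>
  have "AE \<omega> in M. \<forall>i. X \<omega> i \<notin> {0}"
    using poisson_process_avoids_null_set[OF assms(1,5,3), of "{0}"]
    by (simp add: AE_all_countable null_sets_def)
  then have ae: "AE \<omega> in M. inj (X \<omega>) \<and> inj (?Z \<omega>) \<and> (\<forall>B. bounded B \<longrightarrow> finite (range (Y \<omega>) \<inter> B))"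
    using poisson_process_AE(1)[OF assms(5)] poisson_process_AE(2)[OF assms(6)]
  proof eventually_elim
    case (elim \<omega>)
    then have "inj (?Z \<omega>)" by (intro inj_case_nat) auto
    then show ?case using elim by simp
  qed
  have "(\<integral>\<^sup>+\<omega>. out_deg L X \<Phi> Y \<omega> \<partial>M)
      = (\<integral>\<^sup>+\<omega>. (\<Sum>i. indicator {\<omega>. secure_link L 0 (\<Phi> \<omega> 0) (range (Y \<omega>)) (X \<omega> i)} \<omega>) \<partial>M)"
  \<comment> \<open>Almost surely the points are distinct, so the first-occurrence condition always
    holds and edges are secure links.\<close>
  proof (intro nn_integral_cong_AE, use ae in eventually_elim)
    case (elim \<omega>)
    \<comment> \<open>In \<open>?Z\<close> the origin has index 0 and the \<open>i\<close>-th point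
      of \<open>X\<close> has index \<open>Suc i\<close>.\<close>
    then have "(0, X \<omega> i) \<in> typical_edges L X \<Phi> Y \<omega> \<longleftrightarrow> secure_link L 0 (\<Phi> \<omega> 0) (range (Y \<omega>)) (X \<omega> i)" for i
      using mem_secrecy_edges_iff_secure_link[of "?Z \<omega>" "range (Y \<omega>)" 0 "Suc i" L "\<Phi> \<omega>"]
      by (simp add: typical_edges_def)
    with elim show ?case unfolding out_eq by (simp add: indicator_def inj_eq)
  qed
  also have "\<dots> = ennreal (real L * (lam_l / lam_e))"
    by (rule expected_secure_links[OF assms, where s = "\<lambda>_. 0" and t = "\<lambda>x. x" and k = "\<lambda>_. 0"]) simp_all
  finally have out: "(\<integral>\<^sup>+\<omega>. out_deg L X \<Phi> Y \<omega> \<partial>M) = ennreal (real L * (lam_l / lam_e))" .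
  have "(\<integral>\<^sup>+\<omega>. in_deg L X \<Phi> Y \<omega> \<partial>M)
      = (\<integral>\<^sup>+\<omega>. (\<Sum>i. indicator {\<omega>. secure_link L (X \<omega> i) (\<Phi> \<omega> (Suc i)) (range (Y \<omega>)) 0} \<omega>) \<partial>M)"
  proof (intro nn_integral_cong_AE, use ae in eventually_elim)
    case (elim \<omega>)
    \<comment> \<open>The sender now has index \<open>Suc i\<close> in \<open>?Z\<close>, so the
      angle \<open>\<Phi> \<omega> (Suc i)\<close> determines the sector.\<close>
    then have "(X \<omega> i, 0) \<in> typical_edges L X \<Phi> Y \<omega> \<longleftrightarrow> secure_link L (X \<omega> i) (\<Phi> \<omega> (Suc i)) (range (Y \<omega>)) 0" for i
      using mem_secrecy_edges_iff_secure_link[of "?Z \<omega>" "range (Y \<omega>)" "Suc i" 0 L "\<Phi> \<omega>"]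
      by (simp add: typical_edges_def)
    with elim show ?case unfolding in_eq by (simp add: indicator_def inj_eq)
  qed
  also have "\<dots> = ennreal (real L * (lam_l / lam_e))"
    by (rule expected_secure_links[OF assms, where s = "\<lambda>x. x" and t = "\<lambda>_. 0" and k = Suc]) simp_all
  finally have "(\<integral>\<^sup>+\<omega>. in_deg L X \<Phi> Y \<omega> \<partial>M) = ennreal (real L * (lam_l / lam_e))" .
  moreover have "out_deg L X \<Phi> Y \<in> borel_measurable M" unfolding out_eq by measurable
  moreover have "in_deg L X \<Phi> Y \<in> borel_measurable M" unfolding in_eq by measurable
  ultimately show ?thesis using out by simp
qed

end
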